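(* Let the subgraphs $\langle C_1 \rangle_{G_0}$ and $\langle C_2 \rangle_{G_0}$ of the graph $G_0$ be two $q$-cycles as well as $\langle C_1, C_2\rangle_{G_0}$ be an empty graph. Also, let $v_{1, i}$ and $v_{1, j}$ be two non-adjacent vertices of $G_0$. We add the edges $(v_{1, i}, v_{1, j}), (v_{1, i}, v_{2, i})$ and $(v_{1, i}, v_{2, j})$ with $G_0$. The new graph $G$ is non-isomorphic and $Q$-cospectral to its partial transpose.
   Context: Graphs have $n = 2q$ vertices partitioned into clusters $C_1 = \{v_{1,1}, \dots, v_{1,q}\}$ and $C_2 = \{v_{2,1}, \dots, v_{2,q}\}$. $\langle C_\mu \rangle_G$ is the subgraph induced by $C_\mu$, and $\langle C_1, C_2 \rangle_G$ is the spanning subgraph with edges $\{(u,v): u \in C_1, v \in C_2\}$. The $q$-cycles are $(v_{\mu,1}, v_{\mu,2}, \dots, v_{\mu,q})$ in label order. The partial transpose $G^\tau$ is obtained by removing every existing edge $(v_{1,i}, v_{2,j})$ with $i \neq j$ and adding the edge $(v_{1,j}, v_{2,i})$; all other edges are unchanged. The signless Laplacian is $Q(G) = D(G) + A(G)$ (degree matrix plus adjacency matrix), and two graphs are $Q$-cospectral if their signless Laplacian matrices have the same spectrum. *)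

theory Defs
  imports "Jordan_Normal_Form.Char_Poly"
begin

text \<open>Finite simple undirected graphs; an edge is a two-element set of vertices.\<close>

record 'a sgraph =
  vertices :: "'a set"
  edges :: "'a set set"

definition simple_graph :: "'a sgraph \<Rightarrow> bool" where
  "simple_graph G \<longleftrightarrow> finite (vertices G) \<and> (\<forall>e\<in>edges G. e \<subseteq> vertices G \<and> card e = 2)"

definition adjacent :: "'a sgraph \<Rightarrow> 'a \<Rightarrow> 'a \<Rightarrow> bool" where
  "adjacent G u v \<longleftrightarrow> {u, v} \<in> edges G"

definition vertex_degree :: "'a sgraph \<Rightarrow> 'a \<Rightarrow> nat" where
  "vertex_degree G v = card {e \<in> edges G. v \<in> e}"

definition isomorphic :: "'a sgraph \<Rightarrow> 'b sgraph \<Rightarrow> bool" where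
  "isomorphic G H \<longleftrightarrow> (\<exists>f. bij_betw f (vertices G) (vertices H) \<and>
     (\<forall>u\<in>vertices G. \<forall>v\<in>vertices G. adjacent G u v \<longleftrightarrow> adjacent H (f u) (f v)))"

definition induced_subgraph :: "'a sgraph \<Rightarrow> 'a set \<Rightarrow> 'a sgraph" where
  "induced_subgraph G S = \<lparr>vertices = S, edges = {e \<in> edges G. e \<subseteq> S}\<rparr>"

definition cross_subgraph :: "'a sgraph \<Rightarrow> 'a set \<Rightarrow> 'a set \<Rightarrow> 'a sgraph" where
  "cross_subgraph G S T =
     \<lparr>vertices = vertices G, edges = {e \<in> edges G. \<exists>u\<in>S. \<exists>v\<in>T. e = {u, v}}\<rparr>"

definition empty_graph :: "'a sgraph \<Rightarrow> bool" where
  "empty_graph G \<longleftrightarrow> edges G = {}"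

definition add_edges :: "'a sgraph \<Rightarrow> 'a set set \<Rightarrow> 'a sgraph" where
  "add_edges G F = \<lparr>vertices = vertices G, edges = edges G \<union> F\<rparr>"

text \<open>The vertex \<open>v\<^bsub>\<mu>,k\<^esub>\<close> (with \<open>\<mu> \<in> {1, 2}\<close> and \<open>1 \<le> k \<le> q\<close>) is the pair \<open>(\<mu>, k)\<close>.\<close>

type_synonym vertex = "nat \<times> nat"

definition cluster :: "nat \<Rightarrow> nat \<Rightarrow> vertex set" where
  "cluster q \<mu> = {\<mu>} \<times> {1..q}"

definition clustered_graph :: "nat \<Rightarrow> vertex sgraph \<Rightarrow> bool" where
  "clustered_graph q G \<longleftrightarrow> simple_graph G \<and> vertices G = cluster q 1 \<union> cluster q 2"

text \<open>Labels start at 1, so the cyclic successor of \<open>k\<close> is \<open>k mod q + 1\<close>.\<close>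

definition cycle_graph :: "nat \<Rightarrow> nat \<Rightarrow> vertex sgraph" where
  "cycle_graph q \<mu> =
     \<lparr>vertices = cluster q \<mu>, edges = {{(\<mu>, k), (\<mu>, k mod q + 1)} | k. k \<in> {1..q}}\<rparr>"

text \<open>All cross edges with \<open>k \<noteq> l\<close> are transposed simultaneously.\<close>

definition partial_transpose :: "vertex sgraph \<Rightarrow> vertex sgraph" where
  "partial_transpose G =
     \<lparr>vertices = vertices G,
      edges = (edges G - {{(1, k), (2, l)} | k l. k \<noteq> l}) \<union>
              {{(1, l), (2, k)} | k l. k \<noteq> l \<and> adjacent G (1, k) (2, l)}\<rparr>"

text \<open>Matrices are taken with respect to an enumeration of the vertices.\<close>

definition adjacency_matrix :: "'a list \<Rightarrow> 'a sgraph \<Rightarrow> real mat" where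
  "adjacency_matrix vs G = mat (length vs) (length vs)
     (\<lambda>(a, b). if adjacent G (vs ! a) (vs ! b) then 1 else 0)"

definition degree_matrix :: "'a list \<Rightarrow> 'a sgraph \<Rightarrow> real mat" where
  "degree_matrix vs G = mat (length vs) (length vs)
     (\<lambda>(a, b). if a = b then real (vertex_degree G (vs ! a)) else 0)"

definition signless_laplacian :: "'a list \<Rightarrow> 'a sgraph \<Rightarrow> real mat" where
  "signless_laplacian vs G = degree_matrix vs G + adjacency_matrix vs G"

text \<open>The eigenvalues with their algebraic multiplicities.\<close>

definition mat_spectrum :: "real mat \<Rightarrow> complex multiset" where
  "mat_spectrum M = proots (char_poly (map_mat complex_of_real M))"

definition vertex_list :: "nat \<Rightarrow> vertex list" where
  "vertex_list q = map (Pair 1) [1..<q+1] @ map (Pair 2) [1..<q+1]"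

definition Q_cospectral :: "nat \<Rightarrow> vertex sgraph \<Rightarrow> vertex sgraph \<Rightarrow> bool" where
  "Q_cospectral q G H \<longleftrightarrow>
     mat_spectrum (signless_laplacian (vertex_list q) G) =
     mat_spectrum (signless_laplacian (vertex_list q) H)"

end

theory Submission
  imports Defs "HOL-Number_Theory.Cong" "HOL-Combinatorics.Transposition"
begin

text \<open>Let \<open>s\<close> be the reflection of both cycles exchanging the labels \<open>i\<close> and \<open>j\<close>, and let \<open>t\<close> exchange
  the two clusters; both are involutive automorphisms of \<open>G\<^sub>0\<close>, and they commute. As permutation
  matrices they give the involution \<open>P = (1 + s + t - t s) / 2\<close>, which is the identity on
  \<open>s\<close>-symmetric vectors and the cluster exchange on \<open>s\<close>-antisymmetric ones. It commutes with
  \<open>Q(G\<^sub>0)\<close> and maps the incidence vectors of the three edges added to \<open>G\<^sub>0\<close> to those of the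
  corresponding edges of the partial transpose. Hence \<open>P Q(G) P\<close> is the signless Laplacian of the
  partial transpose. The graphs are not isomorphic, because \<open>v\<^bsub>1,i\<^esub>\<close> has degree 5 in \<open>G\<close>, while all
  degrees in the partial transpose are at most 4.\<close>

section \<open>The signless Laplacian as a sum over edges\<close>

text \<open>These are the entries of \<open>B B^T\<close> for the vertex-edge incidence matrix
  \<open>B\<close> of the edge set. Taking the edge set rather than the graph as argument lets
  \<open>G\<^sub>0\<close> and the added edges be treated separately.\<close>

definition joint_incidence :: "'a set set \<Rightarrow> 'a \<Rightarrow> 'a \<Rightarrow> nat" where
  "joint_incidence E u v = card {e \<in> E. u \<in> e \<and> v \<in> e}"

lemma simple_graph_finite_edges:
  assumes "simple_graph G"
  shows "finite (edges G)"
proof -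
  have "edges G \<subseteq> Pow (vertices G)" "finite (Pow (vertices G))"
    using assms by (auto simp: simple_graph_def)
  then show ?thesis by (rule finite_subset)
qed

lemma not_adjacent_self: "simple_graph G \<Longrightarrow> \<not> adjacent G u u"
  by (auto simp: simple_graph_def adjacent_def)

lemma card_2_eq_doubleton: "card e = 2 \<Longrightarrow> u \<in> e \<Longrightarrow> v \<in> e \<Longrightarrow> u \<noteq> v \<Longrightarrow> e = {u, v}"
  by (auto simp: card_2_iff)

lemma joint_incidence_adjacent:
  assumes "simple_graph G" "u \<noteq> v"
  shows "joint_incidence (edges G) u v = (if adjacent G u v then 1 else 0)"
proof -
  have "{e \<in> edges G. u \<in> e \<and> v \<in> e} = (if adjacent G u v then {{u, v}} else {})"
    using assms card_2_eq_doubleton[of _ u v] by (auto simp: simple_graph_def adjacent_def)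
  then show ?thesis by (simp add: joint_incidence_def)
qed

text \<open>The factorization \<open>Q = B B^T\<close>: on the diagonal the edges counted give the
  degree, and off it at most the one edge joining the two vertices is counted.\<close>

lemma signless_laplacian_eq_joint_incidence:
  assumes "simple_graph G" "distinct vs"
  shows "signless_laplacian vs G =
    mat (length vs) (length vs) (\<lambda>(a, b). real (joint_incidence (edges G) (vs ! a) (vs ! b)))"
proof (rule eq_matI)
  fix a b
  assume "a < dim_row (mat (length vs) (length vs)
      (\<lambda>(a, b). real (joint_incidence (edges G) (vs ! a) (vs ! b))))"
    "b < dim_col (mat (length vs) (length vs)
      (\<lambda>(a, b). real (joint_incidence (edges G) (vs ! a) (vs ! b))))"
  then have ab: "a < length vs" "b < length vs" by auto
  show "signless_laplacian vs G $$ (a, b) = mat (length vs) (length vs)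
      (\<lambda>(a, b). real (joint_incidence (edges G) (vs ! a) (vs ! b))) $$ (a, b)"
  proof (cases "a = b")
    case True
    then show ?thesis using ab not_adjacent_self[OF assms(1)]
      by (simp add: signless_laplacian_def degree_matrix_def adjacency_matrix_def
          vertex_degree_def joint_incidence_def)
  next
    case False
    then have "vs ! a \<noteq> vs ! b" using ab assms(2) by (simp add: nth_eq_iff_index_eq)
    then show ?thesis using ab False joint_incidence_adjacent[OF assms(1)]
      by (simp add: signless_laplacian_def degree_matrix_def adjacency_matrix_def)
  qed
qed (auto simp: signless_laplacian_def degree_matrix_def adjacency_matrix_def)

text \<open>Taking images under \<open>f\<close> matches the edges counted on the two sides. In
  matrix terms, the permutation matrix of an involutive automorphism commutes with
  \<open>B B^T\<close>.\<close>

lemma joint_incidence_involution: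
  assumes inv: "\<And>x. f (f x) = x" and E: "\<And>e. e \<in> E \<Longrightarrow> f ` e \<in> E"
  shows "joint_incidence E (f u) v = joint_incidence E u (f v)"
proof -
  have ff: "f ` f ` e = e" for e using inv by (auto simp: image_iff)
  have mem: "x \<in> f ` e \<longleftrightarrow> f x \<in> e" for x e using inv by (metis image_iff)
  have "bij_betw ((`) f) {e \<in> E. f u \<in> e \<and> v \<in> e} {e \<in> E. u \<in> e \<and> f v \<in> e}"
    by (rule bij_betwI[where g = "(`) f"]) (auto simp: E ff mem inv)
  then show ?thesis unfolding joint_incidence_def by (rule bij_betw_same_card)
qed

lemma joint_incidence_Un:
  assumes "finite E" "finite F" "E \<inter> F = {}"
  shows "joint_incidence (E \<union> F) u v = joint_incidence E u v + joint_incidence F u v"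
proof -
  have "{e \<in> E \<union> F. u \<in> e \<and> v \<in> e} = {e \<in> E. u \<in> e \<and> v \<in> e} \<union> {e \<in> F. u \<in> e \<and> v \<in> e}" by auto
  then show ?thesis using assms unfolding joint_incidence_def
    by (simp add: card_Un_disjoint disjoint_iff)
qed

text \<open>Writes \<open>B B^T\<close> as a sum of rank-one matrices \<open>x x^T\<close>, one for
  the indicator vector \<open>x\<close> of each edge.\<close>

lemma joint_incidence_sum:
  assumes "finite F"
  shows "real (joint_incidence F u v) = (\<Sum>e\<in>F. of_bool (u \<in> e) * of_bool (v \<in> e))"
proof -
  have "{e \<in> F. u \<in> e \<and> v \<in> e} = F \<inter> {e. u \<in> e \<and> v \<in> e}" by auto
  then show ?thesis using assms
    by (simp add: joint_incidence_def flip: of_bool_conj)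
qed

section \<open>Similarity through the involution \<open>P\<close>\<close>

text \<open>Hypothesis \<open>MN\<close> is the entrywise form of \<open>2 P M = 2 N P\<close>.
  Since \<open>P\<close> is its own inverse, this yields \<open>N = P M P\<close>.\<close>

lemma similar_mat_switching:
  fixes s t :: "'a \<Rightarrow> 'a" and M N :: "'a \<Rightarrow> 'a \<Rightarrow> real"
  assumes dist: "distinct vs"
    and s: "\<And>x. s (s x) = x" "\<And>x. x \<in> set vs \<Longrightarrow> s x \<in> set vs"
    and t: "\<And>x. t (t x) = x" "\<And>x. x \<in> set vs \<Longrightarrow> t x \<in> set vs"
    and st: "\<And>x. s (t x) = t (s x)"
    and MN: "\<And>u v. u \<in> set vs \<Longrightarrow> v \<in> set vs \<Longrightarrow>
      M u v + M (s u) v + M (t u) v - M (t (s u)) v =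
      N u v + N u (s v) + N u (t v) - N u (t (s v))"
  shows "similar_mat (mat (length vs) (length vs) (\<lambda>(a, b). N (vs ! a) (vs ! b)))
    (mat (length vs) (length vs) (\<lambda>(a, b). M (vs ! a) (vs ! b)))"
proof -
  define n where "n = length vs"
  define mk :: "('a \<Rightarrow> 'a \<Rightarrow> real) \<Rightarrow> real mat"
    where "mk = (\<lambda>K. mat n n (\<lambda>(a, b). K (vs ! a) (vs ! b)))"
  \<comment> \<open>\<open>K\<close> gives the entries of \<open>P\<close>.\<close>
  define K :: "'a \<Rightarrow> 'a \<Rightarrow> real" where "K = (\<lambda>u w.
    (of_bool (w = u) + of_bool (w = s u) + of_bool (w = t u) - of_bool (w = t (s u))) / 2)"
  have carrier: "mk A \<in> carrier_mat n n" for A by (simp add: mk_def)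
  have mult: "mk A * mk B = mk (\<lambda>u v. \<Sum>w\<in>set vs. A u w * B w v)" for A B
  proof (rule eq_matI)
    fix a b
    assume "a < dim_row (mk (\<lambda>u v. \<Sum>w\<in>set vs. A u w * B w v))"
      "b < dim_col (mk (\<lambda>u v. \<Sum>w\<in>set vs. A u w * B w v))"
    then have "a < n" "b < n" by (auto simp: mk_def)
    moreover have "(\<Sum>c\<in>{0..<n}. A (vs ! a) (vs ! c) * B (vs ! c) (vs ! b)) =
        (\<Sum>w\<in>set vs. A (vs ! a) w * B w (vs ! b))"
      by (rule sum.reindex_bij_betw) (auto simp: n_def dist atLeast0LessThan intro: bij_betw_nth)
    ultimately show "(mk A * mk B) $$ (a, b) =
        mk (\<lambda>u v. \<Sum>w\<in>set vs. A u w * B w v) $$ (a, b)"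
      by (simp add: mk_def scalar_prod_def)
  qed (auto simp: mk_def)
  have cong: "mk A = mk B" if "\<And>u v. u \<in> set vs \<Longrightarrow> v \<in> set vs \<Longrightarrow> A u v = B u v" for A B
    using that by (auto simp: mk_def n_def intro!: eq_matI)
  have K_sum: "(\<Sum>w\<in>set vs. K u w * g w) = (g u + g (s u) + g (t u) - g (t (s u))) / 2"
    if "u \<in> set vs" for u g
  proof -
    have "(\<Sum>w\<in>set vs. of_bool (w = x) * g w) = g x" if "x \<in> set vs" for x
      using that by (simp add: of_bool_def if_distrib[of "\<lambda>c. c * _"] cong: if_cong)
    then show ?thesis using that s(2) t(2)
      unfolding K_def times_divide_eq_left sum_divide_distrib[symmetric]
      by (simp add: ring_distribs sum.distrib sum_subtractf)
  qed
  have seq: "w = s u \<longleftrightarrow> u = s w" and teq: "w = t u \<longleftrightarrow> u = t w"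
    and tseq: "w = t (s u) \<longleftrightarrow> u = t (s w)" for u w
    using s(1) t(1) st by metis+
  have K_sym: "K u w = K w u" for u w
    unfolding K_def using seq[of w u] teq[of w u] tseq[of w u] by (simp add: eq_commute[of w u])
  \<comment> \<open>As \<open>s\<close> and \<open>t\<close> are commuting involutions, the mixed
    terms of \<open>(1 + s + t - t s)^2\<close> cancel and leave 4.\<close>
  have PP: "mk K * mk K = 1\<^sub>m n"
  proof -
    have "mk K * mk K = mk (\<lambda>u v. of_bool (v = u))"
      unfolding mult by (rule cong, subst K_sum) (auto simp: K_def s(1) t(1) st)
    also have "\<dots> = 1\<^sub>m n"
      by (rule eq_matI) (auto simp: mk_def n_def nth_eq_iff_index_eq dist)
    finally show ?thesis .
  qed
  have PM: "mk K * mk M = mk N * mk K"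
    unfolding mult
  proof (rule cong)
    fix u v assume uv: "u \<in> set vs" "v \<in> set vs"
    \<comment> \<open>Symmetry of \<open>K\<close> turns the column sum into a row sum, to which
      \<open>K_sum\<close> applies.\<close>
    have "(\<Sum>w\<in>set vs. N u w * K w v) = (\<Sum>w\<in>set vs. K v w * N u w)"
      by (simp add: K_sym[of _ v] mult.commute)
    with uv MN[OF uv] show "(\<Sum>w\<in>set vs. K u w * M w v) = (\<Sum>w\<in>set vs. N u w * K w v)"
      by (simp add: K_sum)
  qed
  have "mk K * mk M * mk K = mk N * (mk K * mk K)"
    unfolding PM by (rule assoc_mult_mat[OF carrier carrier carrier])
  then have "mk N = mk K * mk M * mk K" using PP carrier[of N] by simp
  then have "similar_mat_wit (mk N) (mk M) (mk K) (mk K)"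
    by (rule similar_mat_witI[OF PP PP _ carrier carrier carrier carrier])
  then show ?thesis unfolding similar_mat_def mk_def n_def by blast
qed

lemma mat_spectrum_similar:
  assumes "similar_mat A B"
  shows "mat_spectrum A = mat_spectrum B"
proof -
  obtain n where "A \<in> carrier_mat n n" "B \<in> carrier_mat n n"
    using similar_matD[OF assms] by auto
  then show ?thesis
    using char_poly_similar[OF assms] by (simp add: mat_spectrum_def of_real_hom.char_poly_hom)
qed

text \<open>The common part \<open>E\<close> commutes with \<open>P\<close> because \<open>s\<close>
  and \<open>t\<close> preserve it. The hypotheses \<open>FF'\<close> say that \<open>P\<close>
  exchanges the indicator vectors \<open>x\<close> of \<open>e\<close> and \<open>y\<close> of
  \<open>h e\<close>, so \<open>P x x^T = y x^T = y y^T P\<close>; summing over \<open>F\<close>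
  gives the intertwining of the remaining parts.\<close>

lemma Q_cospectral_switching:
  assumes G: "simple_graph G" "edges G = E \<union> F" "E \<inter> F = {}"
    and H: "simple_graph H" "edges H = E \<union> F'" "E \<inter> F' = {}"
    and s: "\<And>x. s (s x) = x" "\<And>x. x \<in> set (vertex_list q) \<Longrightarrow> s x \<in> set (vertex_list q)"
      "\<And>e. e \<in> E \<Longrightarrow> s ` e \<in> E"
    and t: "\<And>x. t (t x) = x" "\<And>x. x \<in> set (vertex_list q) \<Longrightarrow> t x \<in> set (vertex_list q)"
      "\<And>e. e \<in> E \<Longrightarrow> t ` e \<in> E"
    and st: "\<And>x. s (t x) = t (s x)"
    and h: "bij_betw h F F'"
    and FF': "\<And>e u. e \<in> F \<Longrightarrow> of_bool (u \<in> e) + of_bool (s u \<in> e) + of_bool (t u \<in> e)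
        - of_bool (t (s u) \<in> e) = (2 :: real) * of_bool (u \<in> h e)"
      "\<And>e u. e \<in> F \<Longrightarrow> of_bool (u \<in> h e) + of_bool (s u \<in> h e) + of_bool (t u \<in> h e)
        - of_bool (t (s u) \<in> h e) = (2 :: real) * of_bool (u \<in> e)"
  shows "Q_cospectral q G H"
proof -
  have fin: "finite E" "finite F" "finite F'"
    using simple_graph_finite_edges[OF G(1)] simple_graph_finite_edges[OF H(1)] G(2) H(2) by auto
  have dist: "distinct (vertex_list q)"
    by (auto simp: vertex_list_def distinct_map inj_on_def)
  let ?E = "\<lambda>u v. real (joint_incidence E u v)"
  let ?F = "\<lambda>u v. real (joint_incidence F u v)"
  let ?F' = "\<lambda>u v. real (joint_incidence F' u v)"
  have E: "?E (s u) v = ?E u (s v)" "?E (t u) v = ?E u (t v)" for u v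
    using joint_incidence_involution[of s E] joint_incidence_involution[of t E] s t by auto
  have F: "?F u v + ?F (s u) v + ?F (t u) v - ?F (t (s u)) v =
      (\<Sum>e\<in>F. 2 * of_bool (u \<in> h e) * of_bool (v \<in> e))" for u v
    unfolding joint_incidence_sum[OF fin(2)]
    by (simp only: sum.distrib[symmetric] sum_subtractf[symmetric] FF'(1)[symmetric] ring_distribs
        cong: sum.cong)
  have "?F' u v = (\<Sum>e\<in>F. of_bool (v \<in> h e) * of_bool (u \<in> h e))" for u v
    unfolding joint_incidence_sum[OF fin(3)]
    by (subst sum.reindex_bij_betw[OF h, symmetric]) (simp add: mult.commute)
  then have F': "?F' u v + ?F' u (s v) + ?F' u (t v) - ?F' u (t (s v)) =
      (\<Sum>e\<in>F. 2 * of_bool (v \<in> e) * of_bool (u \<in> h e))" for u v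
    by (simp only: sum.distrib[symmetric] sum_subtractf[symmetric] FF'(2)[symmetric] ring_distribs
        cong: sum.cong)
  have "similar_mat (signless_laplacian (vertex_list q) H) (signless_laplacian (vertex_list q) G)"
    unfolding signless_laplacian_eq_joint_incidence[OF G(1) dist]
      signless_laplacian_eq_joint_incidence[OF H(1) dist]
  proof (rule similar_mat_switching[where s = s and t = t, OF dist s(1,2) t(1,2) st])
    fix u v
    have "(\<Sum>e\<in>F. 2 * of_bool (u \<in> h e) * of_bool (v \<in> e)) =
        (\<Sum>e\<in>F. 2 * of_bool (v \<in> e) * of_bool (u \<in> h e) :: real)"
      by (simp add: mult_ac)
    then show "real (joint_incidence (edges G) u v) + real (joint_incidence (edges G) (s u) v)
        + real (joint_incidence (edges G) (t u) v) - real (joint_incidence (edges G) (t (s u)) v)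
      = real (joint_incidence (edges H) u v) + real (joint_incidence (edges H) u (s v))
        + real (joint_incidence (edges H) u (t v)) - real (joint_incidence (edges H) u (t (s v)))"
      \<comment> \<open>The last two instances of \<open>E\<close> move \<open>t\<close> and then
        \<open>s\<close> across in the mixed term \<open>t (s u)\<close>.\<close>
      using F[of u v] F'[of u v] E(1)[of u v] E(2)[of u v] E(2)[of "s u" v] E(1)[of u "t v"]
      unfolding G(2) H(2) joint_incidence_Un[OF fin(1,2) G(3)] joint_incidence_Un[OF fin(1,3) H(3)]
      by (simp add: st)
  qed
  then show ?thesis unfolding Q_cospectral_def using mat_spectrum_similar by metis
qed

section \<open>Degrees under isomorphism\<close>

text \<open>Isomorphisms are defined through adjacency of vertices, so degrees are recast as numbers
  of neighbours.\<close>

lemma vertex_degree_card_neighbours: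
  assumes "simple_graph G"
  shows "vertex_degree G v = card {w \<in> vertices G. adjacent G v w}"
proof -
  have "bij_betw (\<lambda>w. {v, w}) {w \<in> vertices G. adjacent G v w} {e \<in> edges G. v \<in> e}"
    unfolding bij_betw_def
  proof
    show "inj_on (\<lambda>w. {v, w}) {w \<in> vertices G. adjacent G v w}"
      by (auto simp: inj_on_def doubleton_eq_iff)
    show "(\<lambda>w. {v, w}) ` {w \<in> vertices G. adjacent G v w} = {e \<in> edges G. v \<in> e}"
    proof (intro equalityI subsetI)
      fix e assume "e \<in> {e \<in> edges G. v \<in> e}"
      then have e: "e \<in> edges G" "v \<in> e" "card e = 2" "e \<subseteq> vertices G"
        using assms by (auto simp: simple_graph_def)
      then obtain w where "e = {v, w}" by (auto simp: card_2_iff)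
      then show "e \<in> (\<lambda>w. {v, w}) ` {w \<in> vertices G. adjacent G v w}"
        using e by (auto simp: adjacent_def)
    qed (auto simp: adjacent_def)
  qed
  then show ?thesis unfolding vertex_degree_def by (rule bij_betw_same_card[symmetric])
qed

lemma isomorphic_vertex_degree:
  assumes "simple_graph G" "simple_graph H" "isomorphic G H" "v \<in> vertices G"
  obtains w where "w \<in> vertices H" "vertex_degree H w = vertex_degree G v"
proof -
  obtain f where f: "bij_betw f (vertices G) (vertices H)"
    "\<And>u v. u \<in> vertices G \<Longrightarrow> v \<in> vertices G \<Longrightarrow> adjacent G u v \<longleftrightarrow> adjacent H (f u) (f v)"
    using assms(3) unfolding isomorphic_def by blast
  have "bij_betw f {w \<in> vertices G. adjacent G v w} {w \<in> vertices H. adjacent H (f v) w}"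
    unfolding bij_betw_imp_surj_on[OF f(1), symmetric]
    using f(2) assms(4) bij_betw_imp_inj_on[OF f(1)] by (auto simp: bij_betw_def inj_on_def)
  then have "vertex_degree H (f v) = vertex_degree G v"
    using assms(1,2) by (simp add: vertex_degree_card_neighbours bij_betw_same_card)
  then show ?thesis using that f(1) assms(4) by (auto simp: bij_betw_def)
qed

section \<open>Reflections of a cycle\<close>

text \<open>The label congruent to \<open>i + j - k\<close> modulo \<open>q\<close>; the summand \<open>q\<close> avoids truncation.\<close>

definition cycle_reflection :: "nat \<Rightarrow> nat \<Rightarrow> nat \<Rightarrow> nat \<Rightarrow> nat" where
  "cycle_reflection q i j k = (if k \<in> {1..q} then (i + j + q - k - 1) mod q + 1 else k)"

lemma cycle_reflection_range: "k \<in> {1..q} \<Longrightarrow> cycle_reflection q i j k \<in> {1..q}"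
  by (auto simp: cycle_reflection_def Suc_le_eq)

text \<open>The labels \<open>1..q\<close> form a complete residue system modulo \<open>q\<close>,
  so the congruence determines the reflected label. Later facts use this instead of the formula with
  truncated subtraction.\<close>

lemma cycle_reflection_eqI:
  assumes "k \<in> {1..q}" "l \<in> {1..q}" "i \<in> {1..q}" "[k + l = i + j] (mod q)"
  shows "cycle_reflection q i j k = l"
proof -
  \<comment> \<open>Adding \<open>k + 1\<close> to both sides removes the subtractions; it is
    cancelled again afterwards.\<close>
  have "[(i + j + q - k - 1) + (k + 1) = (l - 1) + (k + 1)] (mod q)"
    using assms by (simp add: cong_def add.commute)
  then have "[i + j + q - k - 1 = l - 1] (mod q)" by (simp only: cong_add_rcancel_nat)
  then show ?thesis using assms by (auto simp: cycle_reflection_def cong_def)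
qed

lemma cycle_reflection_cong:
  assumes "k \<in> {1..q}" "i \<in> {1..q}"
  shows "[k + cycle_reflection q i j k = i + j] (mod q)"
proof -
  have "[k + ((i + j + q - k - 1) mod q + 1) = k + (i + j + q - k - 1 + 1)] (mod q)"
    by (intro cong_add cong_refl) (simp add: cong_def)
  also have "k + (i + j + q - k - 1 + 1) = i + j + q" using assms by auto
  finally show ?thesis using assms by (simp add: cycle_reflection_def cong_def)
qed

text \<open>The defining congruence is symmetric in a label and its image. Outside
  \<open>1..q\<close> the map is the identity, so the law holds for all \<open>k\<close>, as the
  switching lemma demands.\<close>

lemma cycle_reflection_involution:
  assumes "i \<in> {1..q}"
  shows "cycle_reflection q i j (cycle_reflection q i j k) = k"
proof (cases "k \<in> {1..q}")
  case True
  then show ?thesis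
    using cycle_reflection_eqI cycle_reflection_cong cycle_reflection_range assms
    by (metis add.commute)
next
  case False
  then show ?thesis unfolding cycle_reflection_def by (simp only: if_False)
qed

lemma cycle_reflection_swap:
  assumes "i \<in> {1..q}" "j \<in> {1..q}"
  shows "cycle_reflection q i j i = j" "cycle_reflection q i j j = i"
  using assms by (auto intro!: cycle_reflection_eqI simp: add.commute)

text \<open>A reflection reverses orientation: moving 1 from one summand to the other preserves the
  sum \<open>i + j\<close> modulo \<open>q\<close>.\<close>

lemma cycle_reflection_successor:
  assumes "k \<in> {1..q}" "i \<in> {1..q}"
  shows "cycle_reflection q i j (k mod q + 1) mod q + 1 = cycle_reflection q i j k"
proof -
  let ?r = "cycle_reflection q i j"
  have k': "k mod q + 1 \<in> {1..q}" using assms by (auto simp: Suc_le_eq)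
  have "[k + (?r (k mod q + 1) mod q + 1) = k mod q + (?r (k mod q + 1) + 1)] (mod q)"
    by (intro cong_add cong_refl) (simp_all add: cong_def)
  also have "k mod q + (?r (k mod q + 1) + 1) = k mod q + 1 + ?r (k mod q + 1)" by simp
  also have "[k mod q + 1 + ?r (k mod q + 1) = i + j] (mod q)"
    using cycle_reflection_cong[OF k' assms(2)] .
  finally show ?thesis
    using assms by (intro cycle_reflection_eqI[symmetric]) (auto simp: Suc_le_eq)
qed

lemma cycle_reflection_edges:
  assumes "i \<in> {1..q}" "e \<in> edges (cycle_graph q m)"
  shows "map_prod id (cycle_reflection q i j) ` e \<in> edges (cycle_graph q m)"
proof -
  let ?r = "cycle_reflection q i j"
  obtain k where k: "k \<in> {1..q}" "e = {(m, k), (m, k mod q + 1)}"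
    using assms by (auto simp: cycle_graph_def)
  \<comment> \<open>Because orientation is reversed, the image edge starts at the reflection of the
    old endpoint.\<close>
  let ?l = "?r (k mod q + 1)"
  have "?l \<in> {1..q}" using k by (intro cycle_reflection_range) (auto simp: Suc_le_eq)
  moreover have "map_prod id ?r ` e = {(m, ?l), (m, ?l mod q + 1)}"
    using cycle_reflection_successor[OF k(1) assms(1), of j] k(2) by auto
  ultimately show ?thesis by (auto simp: cycle_graph_def)
qed

section \<open>Degrees in a cycle and the edges of \<open>G\<^sub>0\<close>\<close>

lemma cycle_graph_degree:
  assumes "q \<ge> 3" "k \<in> {1..q}"
  shows "vertex_degree (cycle_graph q m) (m, k) = 2"
proof -
  \<comment> \<open>\<open>p\<close> is the cyclic predecessor of \<open>k\<close>. The bound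
    \<open>q \<ge> 3\<close> keeps it distinct from the successor, so that the two edges at
    \<open>k\<close> differ.\<close>
  define p where "p = (if k = 1 then q else k - 1)"
  have p: "p \<in> {1..q}" "p mod q + 1 = k" "p \<noteq> k" "k mod q + 1 \<noteq> k" "p \<noteq> k mod q + 1"
    using assms by (auto simp: p_def mod_if)
  have "l = p" if "l \<in> {1..q}" "l mod q + 1 = k" for l
    using that p by (auto simp: p_def mod_if split: if_splits)
  then have "{l \<in> {1..q}. k = l \<or> k = l mod q + 1} = {k, p}" using p(1,2) assms(2) by blast
  moreover have "{e \<in> edges (cycle_graph q m). (m, k) \<in> e} =
      (\<lambda>l. {(m, l), (m, l mod q + 1)}) ` {l \<in> {1..q}. k = l \<or> k = l mod q + 1}"
    unfolding cycle_graph_def by fastforce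
  ultimately have "{e \<in> edges (cycle_graph q m). (m, k) \<in> e} =
      {{(m, k), (m, k mod q + 1)}, {(m, p), (m, k)}}"
    using p(2) by simp
  then show ?thesis using p by (simp add: vertex_degree_def doubleton_eq_iff)
qed

lemma clustered_graph_edges:
  assumes "clustered_graph q G"
    and "induced_subgraph G (cluster q 1) = cycle_graph q 1"
    and "induced_subgraph G (cluster q 2) = cycle_graph q 2"
    and "empty_graph (cross_subgraph G (cluster q 1) (cluster q 2))"
  shows "edges G = edges (cycle_graph q 1) \<union> edges (cycle_graph q 2)"
proof -
  have 1: "edges (cycle_graph q 1) = {e \<in> edges G. e \<subseteq> cluster q 1}"
    "edges (cycle_graph q 2) = {e \<in> edges G. e \<subseteq> cluster q 2}"
    unfolding assms(2,3)[symmetric] by (simp_all add: induced_subgraph_def)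
  have "e \<subseteq> cluster q 1 \<or> e \<subseteq> cluster q 2" if e: "e \<in> edges G" for e
  proof -
    obtain u v where uv: "e = {u, v}" "{u, v} \<subseteq> cluster q 1 \<union> cluster q 2"
      using assms(1) e by (fastforce simp: clustered_graph_def simple_graph_def card_2_iff)
    have "\<not> (u \<in> cluster q 1 \<and> v \<in> cluster q 2)" "\<not> (v \<in> cluster q 1 \<and> u \<in> cluster q 2)"
      using assms(4) e uv(1) by (auto simp: empty_graph_def cross_subgraph_def insert_commute)
    then show ?thesis using uv by auto
  qed
  then show ?thesis using 1 by auto
qed

section \<open>The graph and its partial transpose\<close>

theorem theorem1:
  fixes q i j :: nat and G\<^sub>0 G :: "vertex sgraph"
  assumes "q \<ge> 3"
    and "clustered_graph q G\<^sub>0"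
    and "induced_subgraph G\<^sub>0 (cluster q 1) = cycle_graph q 1"
    and "induced_subgraph G\<^sub>0 (cluster q 2) = cycle_graph q 2"
    and "empty_graph (cross_subgraph G\<^sub>0 (cluster q 1) (cluster q 2))"
    and "i \<in> {1..q}" and "j \<in> {1..q}" and "i \<noteq> j"
    and "\<not> adjacent G\<^sub>0 (1, i) (1, j)"
    and "G = add_edges G\<^sub>0 {{(1, i), (1, j)}, {(1, i), (2, i)}, {(1, i), (2, j)}}"
  shows "\<not> isomorphic G (partial_transpose G) \<and> Q_cospectral q G (partial_transpose G)"
proof -
  let ?E = "edges G\<^sub>0" and ?H = "partial_transpose G"
  define F :: "vertex set set" where "F = {{(1, i), (1, j)}, {(1, i), (2, i)}, {(1, i), (2, j)}}"
  \<comment> \<open>Transposition moves only the third added edge: the first lies within a cluster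
    and the second joins equal labels. The star \<open>F\<close> at \<open>(1, i)\<close> thus
    becomes a triangle.\<close>
  define F' :: "vertex set set" where "F' = {{(1, i), (1, j)}, {(1, i), (2, i)}, {(1, j), (2, i)}}"
  have E: "?E = edges (cycle_graph q 1) \<union> edges (cycle_graph q 2)"
    using assms(2-5) by (rule clustered_graph_edges)
  have edge_label: "\<exists>m\<in>{1,2}. \<forall>x\<in>e. fst x = m" if "e \<in> ?E" for e
    using that unfolding E by (auto simp: cycle_graph_def)
  have cross: "{(1, k), (2, l)} \<notin> ?E" for k l using edge_label[of "{(1, k), (2, l)}"] by auto
  have chord: "{(1, i), (1, j)} \<notin> ?E" using assms(9) by (simp add: adjacent_def)
  have EG: "edges G = ?E \<union> F" by (simp add: assms(10) add_edges_def F_def)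
  have disjoint: "?E \<inter> F = {}" "?E \<inter> F' = {}" using chord cross by (auto simp: F_def F'_def)
  have adj: "adjacent G (1, k) (2, l) \<longleftrightarrow> k = i \<and> (l = i \<or> l = j)" for k l
    using cross by (auto simp: adjacent_def EG F_def doubleton_eq_iff)
  have EH: "edges ?H = ?E \<union> F'"
  proof -
    have "edges G - {{(1, k), (2, l)} | k l. k \<noteq> l} =
        ?E \<union> {{(1, i), (1, j)}, {(1, i), (2, i)}}"
      using cross assms(8) by (auto simp: EG F_def doubleton_eq_iff)
    moreover have "{{(1 :: nat, l), (2 :: nat, k)} | k l. k \<noteq> l \<and> adjacent G (1, k) (2, l)} =
        {{(1, j), (2, i)}}"
      using assms(8) unfolding adj by auto
    ultimately show ?thesis by (auto simp: partial_transpose_def F'_def)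
  qed
  have VG: "vertices G = cluster q 1 \<union> cluster q 2"
    using assms(2) by (simp add: assms(10) add_edges_def clustered_graph_def)
  have VH: "vertices ?H = vertices G" by (simp add: partial_transpose_def)
  have G0: "finite (cluster q 1 \<union> cluster q 2)"
    "\<And>e. e \<in> ?E \<Longrightarrow> e \<subseteq> cluster q 1 \<union> cluster q 2 \<and> card e = 2"
    using assms(2) by (auto simp: clustered_graph_def simple_graph_def)
  have G: "simple_graph G" and H: "simple_graph ?H"
    unfolding simple_graph_def VH VG EG EH using G0 assms(6-8)
    by (auto simp: F_def F'_def cluster_def)

  have "\<not> isomorphic G ?H"
  proof
    assume iso: "isomorphic G ?H"
    have E_degree: "joint_incidence ?E v v = 2" if "v \<in> cluster q 1 \<union> cluster q 2" for v
    proof -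
      obtain m k where "v = (m, k)" by (cases v)
      with that have v: "v = (m, k)" "k \<in> {1..q}" "m = 1 \<or> m = 2" by (auto simp: cluster_def)
      have "{e \<in> ?E. v \<in> e} = {e \<in> edges (cycle_graph q m). v \<in> e}"
        using v(1,3) unfolding E by (auto simp: cycle_graph_def)
      then show ?thesis using cycle_graph_degree[OF assms(1) v(2), of m] v(1)
        by (simp add: joint_incidence_def vertex_degree_def)
    qed
    have fin: "finite ?E" "finite F" "finite F'"
      using simple_graph_finite_edges[OF G] by (simp_all add: EG F'_def)
    have degree: "vertex_degree A v = joint_incidence (edges A) v v" for A :: "vertex sgraph" and v
      by (simp add: vertex_degree_def joint_incidence_def)
    have v: "(1, i) \<in> vertices G" using assms(6) by (simp add: VG cluster_def)
    \<comment> \<open>All three edges of the star meet \<open>(1, i)\<close>, which has degree 2 in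
      \<open>G\<^sub>0\<close>.\<close>
    have "{e \<in> F. (1, i) \<in> e \<and> (1, i) \<in> e} = F" by (auto simp: F_def)
    moreover have "card F = 3" using assms(8) by (simp add: F_def doubleton_eq_iff)
    ultimately have "vertex_degree G (1, i) = 5"
      using E_degree v unfolding degree EG joint_incidence_Un[OF fin(1,2) disjoint(1)]
      by (simp add: VG joint_incidence_def[of F])
    moreover obtain w where w: "w \<in> vertices ?H" "vertex_degree ?H w = vertex_degree G (1, i)"
      using isomorphic_vertex_degree[OF G H iso v] .
    moreover have "vertex_degree ?H w \<le> 4"
    proof -
      \<comment> \<open>No vertex lies on all three sides of a triangle.\<close>
      have "\<exists>e\<in>F'. w \<notin> e" using assms(8) by (auto simp: F'_def)
      then have "{e \<in> F'. w \<in> e \<and> w \<in> e} \<subset> F'" by auto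
      then have "joint_incidence F' w w < card F'"
        unfolding joint_incidence_def by (rule psubset_card_mono[OF fin(3)])
      also have "card F' = 3" using assms(8) by (simp add: F'_def doubleton_eq_iff)
      finally show ?thesis using E_degree w(1)
        unfolding degree EH joint_incidence_Un[OF fin(1,3) disjoint(2)] VH VG by simp
    qed
    ultimately show False by simp
  qed
  moreover have "Q_cospectral q G ?H"
  proof -
    let ?r = "cycle_reflection q i j" and ?c = "Transposition.transpose (1 :: nat) 2"
    let ?s = "map_prod id ?r :: vertex \<Rightarrow> vertex" and ?t = "map_prod ?c id :: vertex \<Rightarrow> vertex"
    let ?h = "id({(1, i), (2, j)} := {(1, j), (2, i)}) :: vertex set \<Rightarrow> vertex set"
    have rr: "?r (?r k) = k" for k using assms(6) by (rule cycle_reflection_involution)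
    have ri: "?r k = i \<longleftrightarrow> k = j" and rj: "?r k = j \<longleftrightarrow> k = i" for k
      using cycle_reflection_swap[OF assms(6,7)] rr by metis+
    have c: "?c m = 1 \<longleftrightarrow> m = 2" "?c m = 2 \<longleftrightarrow> m = 1" for m
      by (auto simp: Transposition.transpose_def)
    have V: "set (vertex_list q) = {1, 2} \<times> {1..q}"
      by (auto simp: vertex_list_def)
    show ?thesis
    proof (rule Q_cospectral_switching[OF G EG disjoint(1) H EH disjoint(2),
          where s = ?s and t = ?t and h = ?h])
      show "?s x \<in> set (vertex_list q)" if "x \<in> set (vertex_list q)" for x
        using that cycle_reflection_range[of "snd x" q i j] unfolding V by (cases x) auto
      show "?t x \<in> set (vertex_list q)" if "x \<in> set (vertex_list q)" for x
        using that unfolding V by (cases x) auto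
      show "?s ` e \<in> ?E" if "e \<in> ?E" for e
        using that cycle_reflection_edges[OF assms(6)] unfolding E by blast
      show "?t ` e \<in> ?E" if "e \<in> ?E" for e
        using that unfolding E by (auto simp: cycle_graph_def)
      show "bij_betw ?h F F'"
        using assms(8) by (auto simp: bij_betw_def inj_on_def F_def F'_def doubleton_eq_iff)
      fix e and u :: vertex assume "e \<in> F"
      then consider "e = {(1, i), (1, j)}" | "e = {(1, i), (2, i)}" | "e = {(1, i), (2, j)}"
        by (auto simp: F_def)
      note e_cases = this
      have h: "?h {(1, i), (1, j)} = {(1, i), (1, j)}" "?h {(1, i), (2, i)} = {(1, i), (2, i)}"
        "?h {(1, i), (2, j)} = {(1, j), (2, i)}"
        using assms(8) by (auto simp: doubleton_eq_iff)
      obtain m k where u: "u = (m, k)" by (cases u)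
      \<comment> \<open>The identities are required for every pair \<open>u\<close>, hence the third
        cases, where no edge in question contains \<open>u\<close>.\<close>
      have mk: "m = 1 \<or> m = 2 \<or> m \<noteq> 1 \<and> m \<noteq> 2" "k = i \<or> k = j \<or> k \<noteq> i \<and> k \<noteq> j" by auto
      \<comment> \<open>The first edge is fixed by \<open>?s\<close> and the second by
        \<open>?t\<close>, so \<open>P\<close> fixes both indicator vectors. The third is fixed by
        the product, while \<open>?s\<close> and \<open>?t\<close> each send it to
        \<open>{(1, j), (2, i)}\<close>, so \<open>P\<close> does too.\<close>
      show "of_bool (u \<in> e) + of_bool (?s u \<in> e) + of_bool (?t u \<in> e) - of_bool (?t (?s u) \<in> e)
          = (2 :: real) * of_bool (u \<in> ?h e)"
        using mk assms(8) unfolding u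
        by (cases rule: e_cases, simp_all only: h, elim disjE)
          (simp_all add: c ri rj del: One_nat_def)
      show "of_bool (u \<in> ?h e) + of_bool (?s u \<in> ?h e) + of_bool (?t u \<in> ?h e)
          - of_bool (?t (?s u) \<in> ?h e) = (2 :: real) * of_bool (u \<in> e)"
        using mk assms(8) unfolding u
        by (cases rule: e_cases, simp_all only: h, elim disjE)
          (simp_all add: c ri rj del: One_nat_def)
    qed (auto simp: rr)
  qed
  ultimately show ?thesis ..
qed

end
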